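(* Let $\beta$ be the tribonacci number, i.e. the unique root in $(1,2)$ of $x^3=x^2+x+1$. Then $$S_\beta(3m)=\begin{cases} \dfrac{1+\beta+\beta^{3z+2}+\beta^{6z+1}-\beta^{3z+1}-\beta^{6z}-\beta^{9z-1}-\beta^{9z+1}}{(1-\beta^3)(\beta^{9z}-1)}, & m=3z,\ z\ge 1,\\[2mm] \dfrac{1+\beta+\beta^{3z+2}+\beta^{6z+4}-\beta^{3z+1}-\beta^{6z+3}-\beta^{9z+2}-\beta^{9z+4}}{(1-\beta^3)(\beta^{9z+3}-1)}, & m=3z+1,\ z\ge 1,\\[2mm] \dfrac{1+\beta+\beta^{3z+2}+\beta^{6z+7}-\beta^{3z+1}-\beta^{6z+6}-\beta^{9z+5}-\beta^{9z+7}}{(1-\beta^3)(\beta^{9z+6}-1)}, & m=3z+2,\ z\ge 1, \end{cases}$$ where $m,z$ denote integers. Moreover, along the periods $p=3m$, $m\ge 3$, the value $S_\beta(p)$ is increasing in $p$ and converges to $\frac{\beta^2+1}{\beta^4-\beta}$ as $p\to\infty$.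
   Context: For $\beta\in(1,2]$ let $T_\beta:[0,1)\to[0,1)$, $T_\beta(x)=\beta x \pmod 1$. For $t\in[0,1)$ the survivor set is $K_\beta(t)=\{x\in[0,1): T_\beta^n(x)\ge t \text{ for all } n\ge 0\}$. A point $x$ has smallest period $p$ if $T_\beta^p(x)=x$ and $T_\beta^j(x)\ne x$ for all $1\le j<p$. For a positive integer $p$, $$S_\beta(p)=\sup\{t\in[0,1): K_\beta(t)\text{ contains a point of smallest period } p\}.$$ *)

theory Defs
  imports "HOL-Analysis.Analysis"
begin

definition beta_map :: "real \<Rightarrow> real \<Rightarrow> real"
  where "beta_map \<beta> x = frac (\<beta> * x)"

definition survivor_set :: "real \<Rightarrow> real \<Rightarrow> real set"
  where "survivor_set \<beta> t = {x \<in> {0..<1}. \<forall>n. t \<le> (beta_map \<beta> ^^ n) x}"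

definition has_smallest_period :: "('a \<Rightarrow> 'a) \<Rightarrow> nat \<Rightarrow> 'a \<Rightarrow> bool"
  where "has_smallest_period f p x \<longleftrightarrow>
    0 < p \<and> (f ^^ p) x = x \<and> (\<forall>j. 1 \<le> j \<and> j < p \<longrightarrow> (f ^^ j) x \<noteq> x)"

(* The set below is bounded by 1.  Where it is empty, Sup has an unspecified value. *)
definition S_beta :: "real \<Rightarrow> nat \<Rightarrow> real"
  where "S_beta \<beta> p =
    Sup {t \<in> {0..<1}. \<exists>x \<in> survivor_set \<beta> t. has_smallest_period (beta_map \<beta>) p x}"

definition tribonacci :: real
  where "tribonacci = (THE x. x \<in> {1<..<2} \<and> x ^ 3 = x ^ 2 + x + 1)"

lemma ex1_tribonacci: "\<exists>!x::real. x \<in> {1<..<2} \<and> x ^ 3 = x ^ 2 + x + 1"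
proof (rule ex_ex1I)
  have "\<exists>x\<ge>1. x \<le> (2::real) \<and> x ^ 3 - x ^ 2 - x - 1 = 0"
    by (rule IVT') (auto intro!: continuous_intros)
  then obtain x :: real where x: "1 \<le> x" "x \<le> 2" "x ^ 3 - x ^ 2 - x - 1 = 0"
    by blast
  moreover from x(3) have "x \<noteq> 1" "x \<noteq> 2" by auto
  ultimately show "\<exists>x::real. x \<in> {1<..<2} \<and> x ^ 3 = x ^ 2 + x + 1"
    by (intro exI[of _ x]) auto
next
  fix x y :: real
  assume x: "x \<in> {1<..<2} \<and> x ^ 3 = x ^ 2 + x + 1"
    and y: "y \<in> {1<..<2} \<and> y ^ 3 = y ^ 2 + y + 1"
  have "(x - y) * (x * (x - 1) + y * (y - 1) + (x * y - 1)) =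
      (x ^ 3 - x ^ 2 - x) - (y ^ 3 - y ^ 2 - y)"
    by (simp add: algebra_simps power2_eq_square power3_eq_cube)
  also have "\<dots> = 0" using x y by simp
  finally have "(x - y) * (x * (x - 1) + y * (y - 1) + (x * y - 1)) = 0" .
  moreover have "x * (x - 1) + y * (y - 1) + (x * y - 1) > 0"
  proof -
    have "x * (x - 1) > 0" "y * (y - 1) > 0" using x y by auto
    moreover have "x * y > 1" using x y by (simp add: less_1_mult)
    ultimately show ?thesis by linarith
  qed
  ultimately show "x = y" by simp
qed

lemma tribonacci: "1 < tribonacci" "tribonacci < 2"
    "tribonacci ^ 3 = tribonacci ^ 2 + tribonacci + 1"
  using theI'[OF ex1_tribonacci, folded tribonacci_def] by auto

end

theory Submission
  imports Defs
begin

text \<open>A point of \<open>[0,1)\<close> is described by its itinerary of digits. Since \<open>1/\<beta> + 1/\<beta>^2 + 1/\<beta>^3 = 1\<close>,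
  no itinerary contains \<open>111\<close>, and \<open>1/\<beta>\<close> is the value of the expansion \<open>(011)\<^sup>\<infinity>\<close>. A survivor set
  with a large threshold contains no point whose itinerary has two consecutive zeros, so its
  itineraries are concatenations of the blocks \<open>01\<close> and \<open>011\<close>. A period \<open>3m\<close> needs the number of
  blocks \<open>01\<close> to be a multiple of three, and it cannot be zero, because \<open>1/\<beta>\<close> repels under the
  block \<open>011\<close>. The smallest point of the orbit is largest if there are exactly three
  blocks \<open>01\<close> and the blocks \<open>011\<close> are spread between them as evenly as possible:
  for \<open>m = 3n + e + 3\<close> with \<open>e \<le> 2\<close> the best cycle is
  \<open>01 (011)\<^sup>n 01 (011)\<^sup>n\<^sup>+\<^sup>e 01 (011)\<^sup>n\<^sup>+\<^sup>1\<close>. For \<open>e = 2\<close> the perfectly even distribution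
  \<open>n + 1, n + 1, n + 1\<close> would be better, but it has a smaller period; this is why \<open>n, n + 2, n + 1\<close> wins.

  The proof replaces words by one real coordinate, the gap \<open>\<beta>^3 - \<beta>^4 x\<close>, which is the distance from
  \<open>x\<close> to \<open>1/\<beta>\<close> rescaled so that \<open>01\<close> is read exactly when the gap exceeds \<open>1\<close>.
  The block \<open>011\<close> multiplies the gap by \<open>\<beta>^3\<close>, and \<open>01\<close> sends \<open>v\<close> to \<open>\<beta>^2 (v - 1)\<close>.
  Hence two successive gaps \<open>v, v'\<close> above \<open>1\<close>, separated by \<open>01 (011)\<^sup>k\<close>, satisfy
  \<open>v = 1 + v' / \<beta>^(3k+2)\<close>, a kind of continued expansion in which a smaller exponent always gives a
  larger gap (\<open>smaller_exponent\<close>). Minimising the largest gap of a cycle is therefore a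
  lexicographic comparison of exponents (\<open>exponent_ge\<close>, \<open>exponent_eq\<close>). The best cycle is realised in
  \<open>optimal_point\<close>; \<open>survivor_threshold_le\<close> shows that every orbit of
  smallest period \<open>3m\<close> has a gap at least as large. Solving the linear equations of the cycle gives the
  closed form; the monotonicity is one more comparison of exponents, and the limit holds because
  the largest gap of the best cycle tends to \<open>1\<close>.\<close>

section \<open>The map in the gap coordinate\<close>

locale tribonacci_base =
  fixes \<beta> :: real
  assumes gt_1: "1 < \<beta>" and lt_2: "\<beta> < 2" and root: "\<beta> ^ 3 = \<beta> ^ 2 + \<beta> + 1"
begin

lemma power4: "\<beta> ^ 4 = 2 * \<beta> ^ 3 - 1"
proof -
  have "\<beta> ^ 4 = \<beta> * \<beta> ^ 3" by (simp add: power_eq_if)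
  also have "\<dots> = \<beta> * \<beta> ^ 2 + \<beta> ^ 2 + \<beta>"
    by (simp add: root algebra_simps power2_eq_square)
  also have "\<dots> = \<beta> ^ 3 + \<beta> ^ 2 + \<beta>" by (simp add: power_eq_if)
  finally show ?thesis using root by simp
qed

lemma square_ge_2: "2 \<le> \<beta> ^ 2"
proof (rule ccontr)
  assume "\<not> 2 \<le> \<beta> ^ 2"
  then have "\<beta> * \<beta> ^ 2 < \<beta> * 2" using gt_1 by (intro mult_strict_left_mono) auto
  moreover have "\<beta> * \<beta> ^ 2 = \<beta> ^ 2 + \<beta> + 1" using root by (simp add: power_eq_if)
  moreover have "\<beta> < \<beta> ^ 2" using gt_1 by (simp add: power2_eq_square)
  ultimately show False by linarith
qed

lemma base_pos [simp]: "0 < \<beta>" "\<beta> \<noteq> 0" using gt_1 by auto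

text \<open>The factor by which the word \<open>01 (011)\<^sup>k\<close> expands distances.\<close>

definition weight :: "nat \<Rightarrow> real" where "weight k = \<beta> ^ (3 * k + 2)"

lemma weight_split: "weight k = \<beta> ^ 2 * \<beta> ^ (3 * k)"
  by (simp only: weight_def power_add mult.commute)

lemma weight_ge_2: "2 \<le> weight k"
proof -
  have "2 * 1 \<le> \<beta> ^ 2 * \<beta> ^ (3 * k)" using gt_1 square_ge_2 by (intro mult_mono one_le_power) auto
  then show ?thesis by (simp add: weight_split)
qed

lemma weight_pos [simp]: "0 < weight k" "weight k \<noteq> 0"
  by (simp_all add: weight_def)

abbreviation T :: "real \<Rightarrow> real" where "T \<equiv> beta_map \<beta>"

lemma T_digit0: assumes "0 \<le> x" "\<beta> * x < 1" shows "T x = \<beta> * x"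
  using assms gt_1 by (simp add: beta_map_def frac_eq)

lemma T_digit1: assumes "x < 1" "1 \<le> \<beta> * x" shows "T x = \<beta> * x - 1"
proof -
  have "\<beta> * x < \<beta> * 1" using assms(1) by (intro mult_strict_left_mono) auto
  then have "\<beta> * x < 2" using lt_2 by linarith
  then show ?thesis using assms(2) unfolding beta_map_def by (subst frac_unique_iff) auto
qed

lemma T_range: "0 \<le> T x" "T x < 1"
  by (simp_all add: beta_map_def frac_lt_1)

text \<open>The multiple \<open>\<beta>^4\<close> of the distance from \<open>x\<close> to \<open>1/\<beta>\<close>, the right end of the
  interval of digit \<open>0\<close> and the fixed point of the branch \<open>011\<close>. The normalisation puts the border between the blocks
  \<open>01\<close> and \<open>011\<close> at \<open>1\<close>, and the value at \<open>x = 0\<close> is \<open>\<beta>^3\<close>.\<close>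

definition gap :: "real \<Rightarrow> real" where "gap x = \<beta> ^ 3 - \<beta> ^ 4 * x"

lemma gap_less_iff: "gap x < gap y \<longleftrightarrow> y < x"
  using gt_1 by (simp add: gap_def)

lemma gap_le_iff: "gap x \<le> gap y \<longleftrightarrow> y \<le> x"
  using gt_1 by (simp add: gap_def)

lemma gap_eq_iff: "gap x = gap y \<longleftrightarrow> x = y"
  using gt_1 by (simp add: gap_def)

lemma gap_le_cube: "0 \<le> x \<Longrightarrow> gap x \<le> \<beta> ^ 3"
  using gt_1 by (simp add: gap_def)

lemma gap_pos_iff: "0 < gap x \<longleftrightarrow> \<beta> * x < 1"
proof -
  have "gap x = \<beta> ^ 3 * (1 - \<beta> * x)" by (simp add: gap_def algebra_simps power_eq_if)
  then show ?thesis using gt_1 by (simp add: zero_less_mult_iff)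
qed

lemma gap_gt_0_imp_T: "0 \<le> x \<Longrightarrow> 0 < gap x \<Longrightarrow> T x = \<beta> * x"
  by (simp add: T_digit0 gap_pos_iff)

lemma gap_le_0_imp_T: "x < 1 \<Longrightarrow> gap x \<le> 0 \<Longrightarrow> T x = \<beta> * x - 1"
  by (rule T_digit1) (use gap_pos_iff[of x] in auto)

lemma gap_T_digit0: "0 \<le> x \<Longrightarrow> 0 < gap x \<Longrightarrow> gap (T x) = \<beta> * gap x - \<beta> ^ 3 * (\<beta> - 1)"
  by (simp add: gap_gt_0_imp_T) (simp add: gap_def algebra_simps power_eq_if)

lemma gap_T_digit1: "x < 1 \<Longrightarrow> gap x \<le> 0 \<Longrightarrow> gap (T x) = \<beta> * gap x + \<beta> ^ 3"
  by (simp add: gap_le_0_imp_T) (simp add: gap_def algebra_simps power_eq_if)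

text \<open>The bound \<open>\<beta> + 1\<close> on the gap means \<open>x \<ge> 1/\<beta>^2\<close>, that is, digit \<open>0\<close> is followed by digit \<open>1\<close>.
  The conclusion on the second iterate covers both blocks: its sign decides whether a further \<open>1\<close> follows.\<close>

lemma block_01:
  assumes "0 \<le> x" "0 < gap x" "gap x \<le> \<beta> + 1"
  shows "gap (T x) \<le> 0" "gap (T (T x)) = \<beta> ^ 2 * (gap x - 1)"
proof -
  have g: "gap (T x) = \<beta> * gap x - \<beta> ^ 3 * (\<beta> - 1)" using assms by (simp add: gap_T_digit0)
  have e: "\<beta> ^ 3 * (\<beta> - 1) = \<beta> * (\<beta> + 1)"
    using root power4 by (simp add: algebra_simps power_eq_if)
  show 1: "gap (T x) \<le> 0" unfolding g e using assms gt_1 by simp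
  have "gap (T (T x)) = \<beta> * gap (T x) + \<beta> ^ 3" using 1 by (simp add: gap_T_digit1 T_range)
  also have "\<dots> = \<beta> ^ 2 * (gap x - 1)" unfolding g e
    by (simp add: root power2_eq_square algebra_simps) (use root in \<open>simp add: power_eq_if algebra_simps\<close>)
  finally show "gap (T (T x)) = \<beta> ^ 2 * (gap x - 1)" .
qed

text \<open>After \<open>01\<close> the point still has digit \<open>1\<close>. The third step sends the gap \<open>\<beta>^2 (gap x - 1)\<close> to
  \<open>\<beta>^3 (gap x - 1) + \<beta>^3\<close>, so the constants cancel: \<open>1/\<beta>\<close> has gap \<open>0\<close> and is fixed by this branch.\<close>

lemma block_011:
  assumes "0 \<le> x" "0 < gap x" "gap x \<le> 1"
  shows "gap (T x) \<le> 0" "gap (T (T x)) \<le> 0" "gap (T (T (T x))) = \<beta> ^ 3 * gap x"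
proof -
  have x: "gap x \<le> \<beta> + 1" using assms gt_1 by simp
  show "gap (T x) \<le> 0" using block_01(1)[OF assms(1,2) x] .
  have g: "gap (T (T x)) = \<beta> ^ 2 * (gap x - 1)" using block_01(2)[OF assms(1,2) x] .
  show 1: "gap (T (T x)) \<le> 0" unfolding g using assms by (simp add: mult_nonneg_nonpos)
  have "gap (T (T (T x))) = \<beta> * gap (T (T x)) + \<beta> ^ 3" using 1 by (simp add: gap_T_digit1 T_range)
  then show "gap (T (T (T x))) = \<beta> ^ 3 * gap x" unfolding g
    by (simp add: algebra_simps power_eq_if)
qed

text \<open>As long as the product stays at most \<open>\<beta>^3\<close>, the gap was at most \<open>1\<close> before each block, so every
  block really is \<open>011\<close>. The bound on the intermediate gaps says that the orbit does not meet the
  section \<open>gap > 1\<close> on the way.\<close>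

lemma blocks_011:
  assumes "0 \<le> x" "0 < gap x" "\<beta> ^ (3 * k) * gap x \<le> \<beta> ^ 3"
  shows "gap ((T ^^ (3 * k)) x) = \<beta> ^ (3 * k) * gap x \<and> (\<forall>j < 3 * k. gap ((T ^^ j) x) \<le> 1)"
  using assms
proof (induction k arbitrary: x)
  case 0
  then show ?case by simp
next
  case (Suc k)
  have "\<beta> ^ 3 * (\<beta> ^ (3 * k) * gap x) \<le> \<beta> ^ 3 * 1"
    using Suc.prems(3) by (simp add: power_add mult.assoc)
  then have k: "\<beta> ^ (3 * k) * gap x \<le> 1"
    by (rule mult_left_le_imp_le) simp
  have "1 * gap x \<le> \<beta> ^ (3 * k) * gap x"
    using Suc.prems(2) gt_1 by (intro mult_right_mono one_le_power) auto
  with k have "gap x \<le> 1" by simp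
  note b = block_011[OF Suc.prems(1,2) this]
  let ?y = "T (T (T x))"
  have y: "(T ^^ (3 + j)) x = (T ^^ j) ?y" for j
    by (simp only: add.commute[of 3 j] funpow_add o_apply) (simp add: numeral_3_eq_3)
  have "gap ((T ^^ (3 * k)) ?y) = \<beta> ^ (3 * k) * gap ?y \<and> (\<forall>j < 3 * k. gap ((T ^^ j) ?y) \<le> 1)"
  proof (rule Suc.IH)
    show "\<beta> ^ (3 * k) * gap ?y \<le> \<beta> ^ 3"
      using Suc.prems(3) by (simp add: b power_add mult_ac)
  qed (use T_range Suc.prems(2) in \<open>auto simp: b\<close>)
  note IH = conjunct1[OF this] conjunct2[OF this]
  have "gap ((T ^^ j) x) \<le> 1" if "j < 3 * Suc k" for j
  proof -
    consider "j = 0" | "j = 1" | "j = 2" | i where "j = 3 + i" "i < 3 * k"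
    proof (cases "j < 3")
      case True
      then have "j = 0 \<or> j = 1 \<or> j = 2" by linarith
      then show ?thesis using that by blast
    next
      case False
      then show ?thesis using that(4)[of "j - 3"] \<open>j < 3 * Suc k\<close> by simp
    qed
    then show ?thesis
      by cases (use b(1,2) \<open>gap x \<le> 1\<close> IH(2) in \<open>simp_all add: y numeral_2_eq_2\<close>)
  qed
  moreover have "gap ((T ^^ (3 * Suc k)) x) = \<beta> ^ (3 * Suc k) * gap x"
    by (simp only: mult_Suc_right y IH(1) b(3)) (simp add: power_add mult_ac)
  ultimately show ?case by blast
qed

section \<open>Returns to the section of points with gap above one\<close>

text \<open>The word \<open>01 (011)\<^sup>k\<close> in gap coordinates. Both halves of the proof use it: read from left to right
  it describes a given orbit, and with a prescribed \<open>w\<close> it constructs one.\<close>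

lemma return_word:
  assumes "0 \<le> x" "gap x \<le> \<beta> + 1" "gap x = 1 + w / weight k" "0 < w" "w \<le> \<beta> ^ 3"
  shows "gap ((T ^^ (3 * k + 2)) x) = w" "\<And>j. 0 < j \<Longrightarrow> j < 3 * k + 2 \<Longrightarrow> gap ((T ^^ j) x) \<le> 1"
proof -
  have "0 < w / weight k" using assms by (intro divide_pos_pos) auto
  then have pos: "0 < gap x" using assms(3) by linarith
  note b = block_01[OF assms(1) pos assms(2)]
  let ?y = "T (T x)"
  have y: "(T ^^ (j + 2)) x = (T ^^ j) ?y" for j
    by (simp only: funpow_add o_apply) (simp add: numeral_2_eq_2)
  have g: "gap ?y = w / \<beta> ^ (3 * k)"
    using gt_1 by (simp add: b assms(3) weight_split)
  have "gap ((T ^^ (3 * k)) ?y) = \<beta> ^ (3 * k) * gap ?y \<and> (\<forall>j < 3 * k. gap ((T ^^ j) ?y) \<le> 1)"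
    by (rule blocks_011) (use assms T_range gt_1 in \<open>auto simp: g\<close>)
  note ys = conjunct1[OF this] conjunct2[OF this]
  show "gap ((T ^^ (3 * k + 2)) x) = w"
    using gt_1 by (simp only: y ys(1)) (simp add: g)
  fix j :: nat assume j: "0 < j" "j < 3 * k + 2"
  show "gap ((T ^^ j) x) \<le> 1"
  proof (cases "j = 1")
    case True
    then show ?thesis using b(1) by simp
  next
    case False
    then obtain i where "j = i + 2" using j by (intro that[of "j - 2"]) auto
    then show ?thesis using j ys(2) by (simp only: y)
  qed
qed

text \<open>The number of blocks \<open>011\<close> that a point with gap \<open>s\<close> reads before it returns to the section:
  the least \<open>k\<close> for which the gap exceeds \<open>1\<close>. Minimality keeps the gap at most \<open>\<beta>^3\<close>.\<close>

lemma rescale: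
  assumes "0 < s" "s \<le> \<beta> ^ 3"
  obtains k where "1 < \<beta> ^ (3 * k) * s" "\<beta> ^ (3 * k) * s \<le> \<beta> ^ 3"
proof -
  have "1 < \<beta> ^ 3" using gt_1 by (simp add: one_less_power)
  then obtain n where "1 / s < (\<beta> ^ 3) ^ n" using real_arch_pow by blast
  then have ex: "1 < \<beta> ^ (3 * n) * s" using assms(1) by (simp add: power_mult divide_less_eq)
  define k where "k = (LEAST k. 1 < \<beta> ^ (3 * k) * s)"
  have k: "1 < \<beta> ^ (3 * k) * s" unfolding k_def by (rule LeastI[of _ n]) (rule ex)
  have "\<beta> ^ (3 * k) * s \<le> \<beta> ^ 3"
  proof (cases k)
    case 0
    then show ?thesis using assms by simp
  next
    case (Suc i)
    then have "\<not> 1 < \<beta> ^ (3 * i) * s" unfolding k_def by (intro not_less_Least) simp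
    then have "\<beta> ^ 3 * (\<beta> ^ (3 * i) * s) \<le> \<beta> ^ 3 * 1" by (intro mult_left_mono) (auto intro: less_imp_le)
    then show ?thesis by (simp add: Suc power_add mult_ac)
  qed
  with k show ?thesis using that by blast
qed

text \<open>Since the orbit stays outside the section between two returns, any time \<open>N\<close> at which it is in the
  section is at least the return time. This is what makes a period a sum of return times.\<close>

lemma first_return:
  assumes "0 \<le> x" "1 < gap x" "gap x \<le> \<beta> + 1" "0 < N" "1 < gap ((T ^^ N) x)"
  obtains k where "3 * k + 2 \<le> N" "1 < gap ((T ^^ (3 * k + 2)) x)"
    "gap x = 1 + gap ((T ^^ (3 * k + 2)) x) / weight k"
proof -
  have "\<beta> ^ 2 * (gap x - 1) \<le> \<beta> ^ 2 * \<beta>" using assms by (intro mult_left_mono) auto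
  also have "\<dots> = \<beta> ^ 3" by (simp add: power_eq_if)
  finally have le: "\<beta> ^ 2 * (gap x - 1) \<le> \<beta> ^ 3" .
  have "0 < \<beta> ^ 2 * (gap x - 1)" using assms(2) by simp
  then obtain k where "1 < \<beta> ^ (3 * k) * (\<beta> ^ 2 * (gap x - 1))"
      "\<beta> ^ (3 * k) * (\<beta> ^ 2 * (gap x - 1)) \<le> \<beta> ^ 3"
    using le by (rule rescale)
  moreover define w where "w = \<beta> ^ (3 * k) * (\<beta> ^ 2 * (gap x - 1))"
  ultimately have k: "1 < w" "w \<le> \<beta> ^ 3" by simp_all
  have w: "gap x = 1 + w / weight k" by (simp add: w_def weight_split)
  have "0 < w" using k(1) by simp
  note r = return_word[OF assms(1,3) w this k(2)]
  have "3 * k + 2 \<le> N"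
  proof (rule ccontr)
    assume "\<not> 3 * k + 2 \<le> N"
    then have "gap ((T ^^ N) x) \<le> 1" using assms(4) by (intro r(2)) auto
    with assms(5) show False by simp
  qed
  then show ?thesis using w k(1) by (intro that[of k]) (simp_all only: r(1))
qed

section \<open>Comparing gaps by their exponents\<close>

text \<open>Increasing the exponent by one costs the factor \<open>\<beta>^3\<close>, which exceeds the ratio of any two
  admissible gaps because \<open>\<beta> + 1 < \<beta>^3\<close>. So gaps are ordered like their exponent sequences, in reverse
  lexicographic order.\<close>

lemma smaller_exponent:
  assumes "k < l" "1 < v" "0 < w" "w \<le> \<beta> + 1"
  shows "1 + w / weight l < 1 + v / weight k"
proof -
  have "3 * l + 2 = 3 + 3 * (l - k - 1) + (3 * k + 2)" using assms(1) by simp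
  then have l: "weight l = \<beta> ^ 3 * \<beta> ^ (3 * (l - k - 1)) * weight k"
    by (simp only: weight_def power_add)
  define D where "D = \<beta> ^ 3 * \<beta> ^ (3 * (l - k - 1))"
  have "\<beta> ^ 3 * 1 \<le> D" unfolding D_def using gt_1 by (intro mult_left_mono one_le_power) simp_all
  then have D: "w < D" using root square_ge_2 assms(4) by linarith
  then have "w / D < 1" using assms(3) by (subst divide_less_eq_1_pos) linarith+
  then have "w / D < v" using assms(2) by linarith
  then have "w / D / weight k < v / weight k" by (rule divide_strict_right_mono) simp
  then show ?thesis 
    by (simp only: l D_def[symmetric] divide_divide_eq_left add_less_cancel_left)
qed

text \<open>The solution \<open>u\<close> of the linear system of \<open>cycle_gap_unique\<close>: the gap of the periodic point
  with the itinerary \<open>01 (011)\<^sup>a 01 (011)\<^sup>b 01 (011)\<^sup>c\<close>.\<close>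

definition cycle_gap :: "nat \<Rightarrow> nat \<Rightarrow> nat \<Rightarrow> real" where
  "cycle_gap a b c = (1 + 1 / weight a + 1 / (weight a * weight b)) /
     (1 - 1 / (weight a * weight b * weight c))"

lemma weights_ge: "4 \<le> weight a * weight b"
   "8 \<le> weight a * weight b * weight c"
proof -
  have "2 * 2 \<le> weight a * weight b"
    by (intro mult_mono weight_ge_2) (use weight_ge_2[of a] in auto)
  then show 1: "4 \<le> weight a * weight b" by simp
  have "4 * 2 \<le> weight a * weight b * weight c"
    by (intro mult_mono weight_ge_2 1) (use 1 in auto)
  then show "8 \<le> weight a * weight b * weight c" by simp
qed

lemma cycle_gap_unique:
  assumes "u = 1 + v / weight a" "v = 1 + w / weight b" "w = 1 + u / weight c"
  shows "u = cycle_gap a b c"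
proof -
  define A B C where abc: "A = weight a" "B = weight b" "C = weight c"
  have ge: "2 \<le> A" "2 \<le> B" "2 \<le> C" "8 \<le> A * B * C"
    unfolding abc by (intro weight_ge_2 weights_ge)+
  have "u * (1 - 1 / (A * B * C)) = 1 + 1 / A + 1 / (A * B)"
    using assms ge unfolding abc[symmetric] by (simp add: field_simps)
  moreover have "1 - 1 / (A * B * C) \<noteq> 0" using ge by auto
  ultimately show ?thesis unfolding cycle_gap_def abc[symmetric] by (simp add: eq_divide_eq)
qed

lemma cycle_gap_step: "cycle_gap a b c = 1 + cycle_gap b c a / weight a"
proof -
  define A B C where abc: "A = weight a" "B = weight b" "C = weight c"
  have ge: "2 \<le> A" "2 \<le> B" "2 \<le> C" "8 \<le> A * B * C"
    unfolding abc by (intro weight_ge_2 weights_ge)+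
  have ne: "B * (C * A) = A * B * C" "A * B * C - 1 \<noteq> 0" using ge by auto
  have "cycle_gap a b c = (A * B * C + B * C + C) / (A * B * C - 1)" 
    unfolding cycle_gap_def abc[symmetric] using ge by (simp add: field_simps)
  note c1 = this
  have "cycle_gap b c a = (A * B * C + C * A + A) / (A * B * C - 1)"
    unfolding cycle_gap_def abc[symmetric] using ge by (simp add: field_simps)
  note c2 = this
  have "X = 1 + Y / A" if "X = p / d" "Y = q / d" "A * p = A * d + q" "d \<noteq> 0" for X Y p q d :: real
  proof -
    have "A * X = A * p / d" using that by simp
    also have "\<dots> = A + Y" using that by (simp only: that(1,2,3) add_divide_distrib) simp
    finally show ?thesis using ge(1) by (simp add: field_simps)
  qed
  note quotient = this
  have "A * (A * B * C + B * C + C) = A * (A * B * C - 1) + (A * B * C + C * A + A)"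
    by (simp add: algebra_simps)
  then show ?thesis unfolding abc(1)[symmetric] by (rule quotient[OF c1 c2 _ ne(2)])
qed

lemma cycle_gap_bounds: "1 < cycle_gap a b c" "cycle_gap a b c \<le> \<beta> + 1"
proof -
  define A B C where abc: "A = weight a" "B = weight b" "C = weight c"
  have ge: "2 \<le> A" "4 \<le> A * B" "8 \<le> A * B * C"
    unfolding abc by (intro weight_ge_2 weights_ge)+
  have u: "1 / A \<le> 1 / 2" "1 / (A * B) \<le> 1 / 4" "1 / (A * B * C) \<le> 1 / 8"
    using ge by (auto simp: divide_le_eq le_divide_eq)
  have p: "0 < 1 / A" "0 < 1 / (A * B)" "0 < 1 / (A * B * C)"
    unfolding abc by (auto intro!: mult_pos_pos)
  show "1 < cycle_gap a b c" unfolding cycle_gap_def abc[symmetric] using u p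
    by (subst less_divide_eq_1_pos) linarith+
  have "cycle_gap a b c \<le> 2" unfolding cycle_gap_def abc[symmetric] using u p
    by (subst pos_divide_le_eq) (simp_all del: zero_less_divide_1_iff)
  then show "cycle_gap a b c \<le> \<beta> + 1" using gt_1 by simp
qed

lemma cycle_gap_less: "a < a' \<Longrightarrow> cycle_gap a' b' c' < cycle_gap a b c"
  using smaller_exponent[OF _ cycle_gap_bounds(1) less_trans[OF zero_less_one cycle_gap_bounds(1)] cycle_gap_bounds(2)]
  by (simp only: cycle_gap_step[of a' b' c'] cycle_gap_step[of a b c])

lemma less_tail: "1 + v / weight k < 1 + w / weight k \<longleftrightarrow> v < w"
  using weight_pos(1)[of k] by (auto simp: divide_less_cancel simp del: weight_pos)

lemma cycle_gap_less_tail: "cycle_gap b' c' a < cycle_gap b c a \<Longrightarrow> cycle_gap a b' c' < cycle_gap a b c"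
  by (simp only: cycle_gap_step[of a b' c'] cycle_gap_step[of a b c] less_tail)


section \<open>The optimal cycle of gaps\<close>

lemma exponent_ge:
  assumes "v = 1 + v' / weight k" "1 < v'" "v < cycle_gap n b c"
  shows "n \<le> k"
proof (rule ccontr)
  assume "\<not> n \<le> k"
  then have "1 + cycle_gap b c n / weight n < 1 + v' / weight k"
    using cycle_gap_bounds[of b c n] assms(2) by (intro smaller_exponent) auto
  then show False using assms cycle_gap_step[of n b c] by simp
qed

text \<open>If the first exponents agree, the comparison passes to the next gaps.\<close>

lemma exponent_eq:
  assumes "v = 1 + v' / weight n" "v < cycle_gap n b c"
  shows "v' < cycle_gap b c n"
  using assms(2) unfolding assms(1) cycle_gap_step[of n b c] by (simp only: less_tail)

text \<open>The first gap of the optimal cycle is its strict maximum, so the corresponding point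
  is the only smallest point of its orbit. For \<open>e = 0\<close> the first two exponents agree and
  the comparison is decided one gap later.\<close>

lemma optimal_cycle_max:
  "cycle_gap (n + e) (n + 1) n < cycle_gap n (n + e) (n + 1)" "cycle_gap (n + 1) n (n + e) < cycle_gap n (n + e) (n + 1)"
proof -
  show "cycle_gap (n + 1) n (n + e) < cycle_gap n (n + e) (n + 1)" by (rule cycle_gap_less) simp
  show "cycle_gap (n + e) (n + 1) n < cycle_gap n (n + e) (n + 1)"
  proof (cases "e = 0")
    case True
    have "cycle_gap n (n + 1) n < cycle_gap n n (n + 1)"
      by (rule cycle_gap_less_tail, rule cycle_gap_less) simp
    with True show ?thesis by simp
  next
    case False
    then show ?thesis by (intro cycle_gap_less) simp
  qed
qed

text \<open>Lexicographic comparison of a cycle of three gaps with the optimal one, when the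
  rotation starts with the least possible exponent \<open>n\<close>. Then the second exponent is at least \<open>n + e\<close>, and the prescribed
  sum of the exponents leaves only the optimal cycle itself and, for \<open>e = 0\<close>, one of its rotations.
  Both attain the optimal gap, which contradicts the strict bounds.\<close>

lemma minimal_first_exponent:
  assumes "u = 1 + v / weight n" "v = 1 + w / weight l" "w = 1 + u / weight k"
    and "1 < u" "1 < v" "1 < w"
    and "u < cycle_gap n (n + e) (n + 1)" "v < cycle_gap n (n + e) (n + 1)" "w < cycle_gap n (n + e) (n + 1)"
    and "k + l = 2 * n + 1 + e"
  shows False
proof -
  have "v < cycle_gap (n + e) (n + 1) n" using assms(1,7) by (rule exponent_eq)
  with assms(2,6) have l: "n + e \<le> l" by (rule exponent_ge)
  have k: "n \<le> k" using assms(3,4,9) by (rule exponent_ge)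
  consider "l = n + e" "k = n + 1" | "l = n + e + 1" "k = n" using l k assms(10) by linarith
  then show False
  proof cases
    case 1
    have "u = cycle_gap n (n + e) (n + 1)"
      by (rule cycle_gap_unique[OF assms(1) assms(2)[unfolded 1] assms(3)[unfolded 1]])
    then show False using assms(7) by simp
  next
    case 2
    have "w = 1 + u / weight n" using assms(3) 2 by simp
    then have "u < cycle_gap (n + e) (n + 1) n" using assms(9) by (rule exponent_eq)
    with assms(1,5) have "n + e \<le> n" by (rule exponent_ge)
    then have "e = 0" by simp
    have "v = 1 + w / weight (n + 1)" using assms(2) 2(1) \<open>e = 0\<close> by simp
    from cycle_gap_unique[OF \<open>w = 1 + u / weight n\<close> assms(1) this]
    have "w = cycle_gap n (n + e) (n + 1)" using \<open>e = 0\<close> by simp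
    then show False using assms(9) by simp
  qed
qed

text \<open>By \<open>minimal_first_exponent\<close>, applied to the three rotations, a better cycle has all its exponents above \<open>n\<close>. With the
  prescribed sum this leaves only \<open>n + 1, n + 1, n + 1\<close>, a cycle that repeats after one return.\<close>

lemma better_cycle_constant:
  assumes "u = 1 + v / weight k0" "v = 1 + w / weight k1" "w = 1 + u / weight k2"
    and "1 < u" "1 < v" "1 < w"
    and "u < cycle_gap n (n + e) (n + 1)" "v < cycle_gap n (n + e) (n + 1)" "w < cycle_gap n (n + e) (n + 1)"
    and "k0 + k1 + k2 = 3 * n + 1 + e" "e \<le> 2"
  shows "u = v"
proof -
  have "k0 \<noteq> n"
  proof
    assume "k0 = n"
    from minimal_first_exponent[OF assms(1)[unfolded this] assms(2-9)] this assms(10) show False by linarith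
  qed
  moreover have "k1 \<noteq> n"
  proof
    assume "k1 = n"
    from minimal_first_exponent[OF assms(2)[unfolded this] assms(3,1,5,6,4,8,9,7)] this assms(10)
    show False by linarith
  qed
  moreover have "k2 \<noteq> n"
  proof
    assume "k2 = n"
    from minimal_first_exponent[OF assms(3)[unfolded this] assms(1,2,6,4,5,9,7,8)] this assms(10)
    show False by linarith
  qed
  moreover have "n \<le> k0" using assms(1,5,7) by (rule exponent_ge)
  moreover have "n \<le> k1" using assms(2,6,8) by (rule exponent_ge)
  moreover have "n \<le> k2" using assms(3,4,9) by (rule exponent_ge)
  ultimately have k: "k0 = n + 1" "k1 = n + 1" "k2 = n + 1" using assms(10,11) by linarith+
  have "u = cycle_gap (n + 1) (n + 1) (n + 1)" "v = cycle_gap (n + 1) (n + 1) (n + 1)"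
    using cycle_gap_unique[OF assms(1,2,3)] cycle_gap_unique[OF assms(2,3,1)] unfolding k .
  then show ?thesis by simp
qed

lemma funpow_T_range: "0 \<le> x \<Longrightarrow> x < 1 \<Longrightarrow> 0 \<le> (T ^^ n) x \<and> (T ^^ n) x < 1"
  by (cases n) (simp_all add: T_range)

section \<open>Orbits as sequences of returns\<close>

text \<open>Digit \<open>1\<close> cannot occur three times in a row, so the orbit meets \<open>[0, 1/\<beta>)\<close>, and
  there blocks \<open>011\<close> multiply the gap until it exceeds \<open>1\<close>.\<close>

lemma visits_section:
  assumes "0 \<le> x" "x < 1"
  obtains i where "1 < gap ((T ^^ i) x)"
proof -
  have *: "\<exists>i. 1 < gap ((T ^^ i) y)" if y: "0 \<le> y" "0 < gap y" for y
  proof -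
    obtain k where k: "1 < \<beta> ^ (3 * k) * gap y" "\<beta> ^ (3 * k) * gap y \<le> \<beta> ^ 3"
      using y gap_le_cube[of y] by (elim rescale)
    have "gap ((T ^^ (3 * k)) y) = \<beta> ^ (3 * k) * gap y"
      using blocks_011[OF y k(2)] by blast
    then show ?thesis using k(1) by (intro exI[of _ "3 * k"]) simp
  qed
  have "0 < gap x \<or> 0 < gap (T x) \<or> 0 < gap (T (T x))"
  proof (rule ccontr)
    assume "\<not> ?thesis"
    then have neg: "gap x \<le> 0" "gap (T x) \<le> 0" "gap (T (T x)) \<le> 0" by auto
    \<comment> \<open>The endpoint \<open>1\<close> has gap \<open>1 - \<beta>^3\<close>; the branch of digit \<open>1\<close> carries this bound to \<open>- \<beta>^2\<close> and then
      to \<open>0\<close>, which is the identity \<open>1 = 1/\<beta> + 1/\<beta>^2 + 1/\<beta>^3\<close>.\<close>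
    have "\<beta> ^ 4 * x < \<beta> ^ 4 * 1" using assms(2) by (intro mult_strict_left_mono) simp_all
    then have "1 - \<beta> ^ 3 < gap x" unfolding gap_def using power4 by linarith
    then have "\<beta> * (1 - \<beta> ^ 3) < \<beta> * gap x" by (intro mult_strict_left_mono) simp_all
    moreover have "\<beta> * (1 - \<beta> ^ 3) + \<beta> ^ 3 = - (\<beta> ^ 2)"
      using power4 root by (simp add: right_diff_distrib power_eq_if)
    ultimately have "- (\<beta> ^ 2) < gap (T x)"
      unfolding gap_T_digit1[OF assms(2) neg(1)] by linarith
    then have "\<beta> * (- (\<beta> ^ 2)) < \<beta> * gap (T x)" by (intro mult_strict_left_mono) simp_all
    moreover have "\<beta> * \<beta> ^ 2 = \<beta> ^ 3" by (simp add: power_eq_if)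
    ultimately show False
      using gap_T_digit1[OF T_range(2) neg(2)] neg(3) by simp
  qed
  then consider "0 < gap x" | "0 < gap (T x)" | "0 < gap (T (T x))" by blast
  then have "\<exists>n. 0 < gap ((T ^^ n) x)"
    by cases (auto intro: exI[of _ 0] exI[of _ 1] exI[of _ 2] simp: numeral_2_eq_2)
  then obtain n where "0 < gap ((T ^^ n) x)" by blast
  with funpow_T_range[OF assms, of n] obtain i where "1 < gap ((T ^^ i) ((T ^^ n) x))"
    using * by blast
  then show ?thesis by (intro that[of "i + n"]) (simp add: funpow_add)
qed

text \<open>A return takes \<open>3k + 2\<close> steps, so a time divisible by three can only be met after a number of returns
  that is a multiple of three. Returns are therefore taken three at a time, with \<open>p1, p2, p3\<close> the times at
  which they happen.\<close>

lemma three_returns: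
  assumes "0 \<le> y" "y < 1" "0 < M" "1 < gap y" "1 < gap ((T ^^ (3 * M)) y)"
    and bound: "\<And>i. gap ((T ^^ i) y) \<le> \<beta> + 1"
  obtains k0 k1 k2 p1 p2 p3 where "k0 + k1 + k2 + 2 \<le> M"
    "p1 = 3 * k0 + 2" "p2 = 3 * k1 + 2 + p1" "p3 = 3 * (k0 + k1 + k2 + 2)"
    "gap y = 1 + gap ((T ^^ p1) y) / weight k0"
    "gap ((T ^^ p1) y) = 1 + gap ((T ^^ p2) y) / weight k1"
    "gap ((T ^^ p2) y) = 1 + gap ((T ^^ p3) y) / weight k2"
    "1 < gap ((T ^^ p1) y)" "1 < gap ((T ^^ p2) y)" "1 < gap ((T ^^ p3) y)"
proof -
  have step: "\<exists>k q. q = 3 * k + 2 + p \<and> q \<le> 3 * M \<and> 1 < gap ((T ^^ q) y) \<and>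
      gap ((T ^^ p) y) = 1 + gap ((T ^^ q) y) / weight k"
    if p: "p < 3 * M" "1 < gap ((T ^^ p) y)" for p
  proof -
    have "(T ^^ (3 * M - p)) ((T ^^ p) y) = (T ^^ (3 * M)) y"
      using p(1) funpow_add[of "3 * M - p" p T] by simp
    then have "1 < gap ((T ^^ (3 * M - p)) ((T ^^ p) y))" using assms(5) by simp
    moreover have "0 < 3 * M - p" using p(1) by simp
    ultimately obtain k where k: "3 * k + 2 \<le> 3 * M - p"
      "1 < gap ((T ^^ (3 * k + 2)) ((T ^^ p) y))"
      "gap ((T ^^ p) y) = 1 + gap ((T ^^ (3 * k + 2)) ((T ^^ p) y)) / weight k"
      using first_return[of "(T ^^ p) y" "3 * M - p"] funpow_T_range[OF assms(1,2)] bound p(2)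
      by metis
    have "(T ^^ (3 * k + 2 + p)) y = (T ^^ (3 * k + 2)) ((T ^^ p) y)"
      by (simp only: funpow_add o_apply)
    then show ?thesis using k p(1)
      by (intro exI[where x = "3 * k + 2 + p"] exI[where x = k]) simp
  qed
  obtain k0 p1 where 1: "p1 = 3 * k0 + 2 + 0" "p1 \<le> 3 * M" "1 < gap ((T ^^ p1) y)"
      "gap ((T ^^ 0) y) = 1 + gap ((T ^^ p1) y) / weight k0"
    using step[of 0] assms(3,4) by auto
  \<comment> \<open>The return times \<open>p1\<close> and \<open>p2\<close> are \<open>2\<close> and \<open>1\<close> modulo three, hence differ from \<open>3 * M\<close>.\<close>
  have "p1 < 3 * M" using 1(1,2) by presburger
  then obtain k1 p2 where 2: "p2 = 3 * k1 + 2 + p1" "p2 \<le> 3 * M" "1 < gap ((T ^^ p2) y)"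
      "gap ((T ^^ p1) y) = 1 + gap ((T ^^ p2) y) / weight k1"
    using step[of p1] 1(3) by blast
  have "p2 < 3 * M" using 1(1) 2(1,2) by presburger
  then obtain k2 p3 where 3: "p3 = 3 * k2 + 2 + p2" "p3 \<le> 3 * M" "1 < gap ((T ^^ p3) y)"
      "gap ((T ^^ p2) y) = 1 + gap ((T ^^ p3) y) / weight k2"
    using step[of p2] 2(3) by blast
  show ?thesis
  proof (rule that[of k0 k1 k2 p1 p2 p3])
    show "p3 = 3 * (k0 + k1 + k2 + 2)" using 1(1) 2(1) 3(1) by simp
    then show "k0 + k1 + k2 + 2 \<le> M" using 3(2) by simp
    show "gap y = 1 + gap ((T ^^ p1) y) / weight k0" using 1(4) by simp
    show "p1 = 3 * k0 + 2" using 1(1) by simp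
  qed (fact 2 3 1)+
qed

definition point_of_gap :: "real \<Rightarrow> real" where "point_of_gap w = (\<beta> ^ 3 - w) / \<beta> ^ 4"

lemma gap_point_of_gap [simp]: "gap (point_of_gap w) = w" by (simp add: gap_def point_of_gap_def)

lemma point_of_gap_range: "1 < w \<Longrightarrow> w \<le> \<beta> + 1 \<Longrightarrow> 0 \<le> point_of_gap w \<and> point_of_gap w < 1"
proof -
  assume w: "1 < w" "w \<le> \<beta> + 1"
  have "0 < \<beta> ^ 3 - w" using w root square_ge_2 by linarith
  moreover have "1 < \<beta> ^ 3" using root square_ge_2 gt_1 by linarith
  then have "\<beta> ^ 3 - w < \<beta> ^ 4" unfolding power4 using w by linarith
  ultimately show ?thesis unfolding point_of_gap_def by (simp add: divide_less_eq)
qed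

lemma smallest_period_shift:
  assumes "has_smallest_period f p x"
  shows "has_smallest_period f p ((f ^^ n) x)"
proof -
  have p: "0 < p" "(f ^^ p) x = x" using assms by (auto simp: has_smallest_period_def)
  have comm: "(f ^^ i) ((f ^^ j) z) = (f ^^ j) ((f ^^ i) z)" for i j z
    using funpow_add[of i j f] funpow_add[of j i f] by (simp add: add.commute fun_eq_iff)
  have undo: "(f ^^ (p * n - n)) ((f ^^ n) x) = x"
  proof -
    have "n \<le> p * n" using p(1) by simp
    then have "(f ^^ (p * n - n)) ((f ^^ n) x) = (f ^^ (p * n)) x"
      using funpow_add[of "p * n - n" n f] by simp
    also have "\<dots> = (f ^^ ((p * n) mod p)) x" using p(2) by (rule funpow_mod_eq[symmetric])
    finally show ?thesis by simp
  qed
  have "(f ^^ j) x = x" if fixed: "(f ^^ j) ((f ^^ n) x) = (f ^^ n) x" for j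
  proof -
    have "(f ^^ j) x = (f ^^ j) ((f ^^ (p * n - n)) ((f ^^ n) x))" by (simp only: undo)
    also have "\<dots> = (f ^^ (p * n - n)) ((f ^^ j) ((f ^^ n) x))" by (rule comm)
    also have "\<dots> = x" by (simp only: fixed undo)
    finally show ?thesis .
  qed
  moreover have "(f ^^ p) ((f ^^ n) x) = (f ^^ n) x" by (simp only: comm[of p n] p(2))
  ultimately show ?thesis using assms unfolding has_smallest_period_def by blast
qed

text \<open>A point that is strictly smaller than the points visited before it recurs at time \<open>p\<close> has
  smallest period \<open>p\<close> and is the best threshold for its own orbit.\<close>

lemma orbit_minimum:
  assumes "0 \<le> x" "x < 1" "0 < p" "(T ^^ p) x = x"
    and less: "\<And>j. 0 < j \<Longrightarrow> j < p \<Longrightarrow> gap ((T ^^ j) x) < gap x"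
  shows "has_smallest_period T p x" "x \<in> survivor_set \<beta> x"
proof -
  show "has_smallest_period T p x"
    unfolding has_smallest_period_def
  proof (intro conjI allI impI)
    fix j assume "1 \<le> j \<and> j < p"
    then have "gap ((T ^^ j) x) < gap x" by (intro less) simp_all
    then show "(T ^^ j) x \<noteq> x" by (auto simp only: less_irrefl)
  qed (fact assms(3,4))+
  have "x \<le> (T ^^ n) x" for n
  proof -
    have "(T ^^ n) x = (T ^^ (n mod p)) x" using assms(4) by (rule funpow_mod_eq[symmetric])
    moreover have "gap ((T ^^ (n mod p)) x) \<le> gap x"
    proof (cases "n mod p = 0")
      case False
      then show ?thesis using less[of "n mod p"] assms(3) by simp
    qed simp
    ultimately show ?thesis by (simp only: gap_le_iff)
  qed
  then show "x \<in> survivor_set \<beta> x" unfolding survivor_set_def using assms(1,2) by simp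
qed

lemma return_point:
  assumes "w = 1 + w' / weight k" "w \<le> \<beta> + 1" "1 < w" "1 < w'" "w' \<le> \<beta> + 1"
  shows "(T ^^ (3 * k + 2)) (point_of_gap w) = point_of_gap w'"
    "\<And>j. 0 < j \<Longrightarrow> j < 3 * k + 2 \<Longrightarrow> gap ((T ^^ j) (point_of_gap w)) \<le> 1"
proof -
  have "0 < w'" "w' \<le> \<beta> ^ 3" using assms root square_ge_2 by linarith+
  note r = return_word[of "point_of_gap w" w' k, unfolded gap_point_of_gap, OF _ assms(2,1) this]
  have pos: "0 \<le> point_of_gap w" using point_of_gap_range assms by blast
  have "gap ((T ^^ (3 * k + 2)) (point_of_gap w)) = gap (point_of_gap w')" using r(1)[OF pos] by (simp only: gap_point_of_gap)
  then show "(T ^^ (3 * k + 2)) (point_of_gap w) = point_of_gap w'" by (simp only: gap_eq_iff)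
  show "gap ((T ^^ j) (point_of_gap w)) \<le> 1" if "0 < j" "j < 3 * k + 2" for j
    using r(2)[OF pos that] .
qed

section \<open>The optimal threshold\<close>

text \<open>The point is the smallest of its orbit: at the returns this is \<open>optimal_cycle_max\<close>, and between
  the returns the gaps are at most \<open>1\<close>.\<close>

lemma optimal_point:
  fixes n e defines "x \<equiv> point_of_gap (cycle_gap n (n + e) (n + 1))"
  shows "has_smallest_period T (3 * (3 * n + e + 3)) x" "x \<in> survivor_set \<beta> x"
proof -
  define u v w where uvw: "u = cycle_gap n (n + e) (n + 1)" "v = cycle_gap (n + e) (n + 1) n"
    "w = cycle_gap (n + 1) n (n + e)"
  note bounds = cycle_gap_bounds[of n "n + e" "n + 1", folded uvw]
    cycle_gap_bounds[of "n + e" "n + 1" n, folded uvw] cycle_gap_bounds[of "n + 1" n "n + e", folded uvw]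
  have steps: "u = 1 + v / weight n" "v = 1 + w / weight (n + e)" "w = 1 + u / weight (n + 1)"
    unfolding uvw by (rule cycle_gap_step)+
  note r = return_point[OF steps(1) bounds(2,1,3,4)] return_point[OF steps(2) bounds(4,3,5,6)]
    return_point[OF steps(3) bounds(6,5,1,2)]
  define p q where pq: "p = 3 * n + 2" "q = 3 * (n + e) + 2 + p"
  have N: "3 * (3 * n + e + 3) = 3 * (n + 1) + 2 + q" unfolding pq by simp
  have x: "x = point_of_gap u" unfolding x_def uvw ..
  have xp: "(T ^^ (j + p)) x = (T ^^ j) (point_of_gap v)" for j
    unfolding x pq funpow_add[of j "3 * n + 2"] o_apply r(1) ..
  have xq: "(T ^^ (j + q)) x = (T ^^ j) (point_of_gap w)" for j
    unfolding pq(2) using xp[of "j + (3 * (n + e) + 2)"]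
    unfolding funpow_add[of j "3 * (n + e) + 2"] o_apply r(3) by (simp only: add.assoc)
  have period: "(T ^^ (3 * (3 * n + e + 3))) x = x"
    unfolding N xq r(5) by (rule x[symmetric])
  have less: "gap ((T ^^ j) x) < gap x" if j: "0 < j" "j < 3 * (3 * n + e + 3)" for j
  proof -
    have "v < u" "w < u" unfolding uvw by (rule optimal_cycle_max)+
    consider "j < p" | "j = p" | i where "j = i + p" "0 < i" "i < 3 * (n + e) + 2" | "j = q"
      | i where "j = i + q" "0 < i" "i < 3 * (n + 1) + 2"
    proof (cases "j \<le> p")
      case True
      then show ?thesis using that(1,2) by linarith
    next
      case False
      show ?thesis
      proof (cases "j \<le> q")
        case True
        then show ?thesis using that(3)[of "j - p"] that(4) False unfolding pq(2) by linarith
      next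
        case False
        then show ?thesis using that(5)[of "j - q"] j unfolding N by linarith
      qed
    qed
    then show ?thesis
    proof cases
      case 1
      then have "gap ((T ^^ j) x) \<le> 1" unfolding x pq using j by (intro r)
      then show ?thesis using bounds by (simp add: x)
    next
      case 2
      then show ?thesis using xp[of 0] \<open>v < u\<close> by (simp add: x)
    next
      case 3
      then have "gap ((T ^^ j) x) \<le> 1" by (simp only: xp r)
      then show ?thesis using bounds by (simp add: x)
    next
      case 4
      then show ?thesis using xq[of 0] \<open>w < u\<close> by (simp add: x)
    next
      case 5
      then have "gap ((T ^^ j) x) \<le> 1" by (simp only: xq r)
      then show ?thesis using bounds by (simp add: x)
    qed
  qed
  have "0 \<le> x" "x < 1" using point_of_gap_range bounds unfolding x by auto
  note m = orbit_minimum[OF this _ period less]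
  show "has_smallest_period T (3 * (3 * n + e + 3)) x" "x \<in> survivor_set \<beta> x"
    by (rule m; simp)+
qed

text \<open>If the threshold exceeded the optimal point, all gaps of the orbit would be below the optimal gap, hence
  all exponents at least \<open>n\<close>. If the period consists of three returns, \<open>better_cycle_constant\<close> shows
  that the period is not the smallest one. With six returns or more, the exponents would have to be distributed among
  more blocks \<open>01\<close>, which forces \<open>n = 0\<close> and then two neighbouring exponents \<open>0\<close>; these already give too large a gap.\<close>

lemma survivor_threshold_le:
  assumes e: "e \<le> 2"
    and x: "x \<in> survivor_set \<beta> t" "has_smallest_period T (3 * (3 * n + e + 3)) x"
  shows "t \<le> point_of_gap (cycle_gap n (n + e) (n + 1))"
proof (rule ccontr)
  define W where "W = cycle_gap n (n + e) (n + 1)"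
  define m where "m = 3 * n + e + 3"
  assume "\<not> t \<le> point_of_gap (cycle_gap n (n + e) (n + 1))"
  then have t: "gap t < W" using gap_less_iff[of t "point_of_gap W"] unfolding gap_point_of_gap W_def by simp
  have x01: "0 \<le> x" "x < 1" and "\<And>i. t \<le> (T ^^ i) x" using x(1) unfolding survivor_set_def by auto
  then have "gap ((T ^^ i) x) < W" for i using t gap_le_iff[of "(T ^^ i) x" t] by (meson le_less_trans)
  moreover obtain i where "1 < gap ((T ^^ i) x)" using visits_section[OF x01] .
  moreover define y where "y = (T ^^ i) x"
  ultimately have y: "1 < gap y" "\<And>j. gap ((T ^^ j) y) < W"
    using funpow_add[of _ i T] by (auto simp: o_def) (metis comp_apply funpow_add)
  have y01: "0 \<le> y" "y < 1" unfolding y_def using funpow_T_range[OF x01] by blast+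
  have per: "has_smallest_period T (3 * m) y" unfolding y_def m_def using x(2) by (rule smallest_period_shift)
  then have per_y: "(T ^^ (3 * m)) y = y" unfolding has_smallest_period_def by blast
  have bound: "gap ((T ^^ j) y) \<le> \<beta> + 1" for j
    using y(2)[of j] cycle_gap_bounds(2)[of n "n + e" "n + 1"] unfolding W_def by linarith
  have "0 < m" "1 < gap ((T ^^ (3 * m)) y)" using y(1) per_y unfolding m_def by simp_all
  then obtain k0 k1 k2 p1 p2 p3 where k: "k0 + k1 + k2 + 2 \<le> m"
    and p: "p1 = 3 * k0 + 2" "p2 = 3 * k1 + 2 + p1" "p3 = 3 * (k0 + k1 + k2 + 2)"
    and r: "gap y = 1 + gap ((T ^^ p1) y) / weight k0"
      "gap ((T ^^ p1) y) = 1 + gap ((T ^^ p2) y) / weight k1"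
      "gap ((T ^^ p2) y) = 1 + gap ((T ^^ p3) y) / weight k2"
    and gt: "1 < gap ((T ^^ p1) y)" "1 < gap ((T ^^ p2) y)" "1 < gap ((T ^^ p3) y)"
    using three_returns[of y m] y01 y(1) bound by metis
  note lt = y(2)[unfolded W_def]
  have y0: "gap y < cycle_gap n (n + e) (n + 1)" using lt[of 0] by simp
  show False
  proof (cases "m = k0 + k1 + k2 + 2")
    case True
    then have "(T ^^ p3) y = y" using per_y p(3) by simp
    then have "gap y = gap ((T ^^ p1) y)"
      using better_cycle_constant[OF r(1,2) _ y(1) gt(1,2) y0 lt lt _ e] r(3) True unfolding m_def by simp
    then have "(T ^^ p1) y = y" by (simp only: gap_eq_iff)
    moreover have "1 \<le> p1" "p1 < 3 * m" using k p(1) by simp_all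
    ultimately show False using per unfolding has_smallest_period_def by blast
  next
    case False
    define y' where "y' = (T ^^ p3) y"
    define M where "M = m - (k0 + k1 + k2 + 2)"
    have M: "0 < M" "3 * M + p3 = 3 * m" unfolding M_def p using False k by simp_all
    have y': "(T ^^ j) y' = (T ^^ (j + p3)) y" for j unfolding y'_def by (simp add: funpow_add)
    have "(T ^^ (3 * M)) y' = y" by (simp only: y' M per_y)
    then have "1 < gap ((T ^^ (3 * M)) y')" using y(1) by simp
    moreover have "0 \<le> y'" "y' < 1" "1 < gap y'" unfolding y'_def
      using funpow_T_range[OF y01] gt(3) by blast+
    moreover have "gap ((T ^^ j) y') \<le> \<beta> + 1" for j unfolding y' by (rule bound)
    ultimately obtain k3 k4 k5 q1 q2 q3 where k': "k3 + k4 + k5 + 2 \<le> M"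
      and r': "gap y' = 1 + gap ((T ^^ q1) y') / weight k3"
        "gap ((T ^^ q1) y') = 1 + gap ((T ^^ q2) y') / weight k4"
        "gap ((T ^^ q2) y') = 1 + gap ((T ^^ q3) y') / weight k5"
      and gt': "1 < gap ((T ^^ q1) y')" "1 < gap ((T ^^ q2) y')" "1 < gap ((T ^^ q3) y')"
      using three_returns[of y' M] M(1) by metis
    note lt' = lt[of "_ + p3", folded y'] and y0' = lt[of p3, folded y'_def]
    have ge: "n \<le> k0" "n \<le> k1" "n \<le> k2" "n \<le> k3" "n \<le> k4" "n \<le> k5"
      using exponent_ge[OF r(1) gt(1) y0] exponent_ge[OF r(2) gt(2) lt] exponent_ge[OF r(3) gt(3) lt]
        exponent_ge[OF r'(1) gt'(1) y0'] exponent_ge[OF r'(2) gt'(2) lt'] exponent_ge[OF r'(3) gt'(3) lt']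
      by blast+
    have sum: "k0 + k1 + k2 + k3 + k4 + k5 + 4 \<le> 3 * n + e + 3" using k' unfolding M_def m_def by linarith
    then have n: "n = 0" using ge e by linarith
    then have e1: "1 \<le> e" using sum by linarith
    \<comment> \<open>Since \<open>n = 0\<close> and \<open>e \<ge> 1\<close>, two neighbouring exponents cannot both vanish. Two disjoint pairs
      contribute at least \<open>2\<close> to the sum, which is at most \<open>e - 1 \<le> 1\<close>.\<close>
    have "k0 \<noteq> n \<or> n + e \<le> k1"
      using exponent_ge[OF r(2) gt(2) exponent_eq[OF _ y0]] r(1) by blast
    moreover have "k2 \<noteq> n \<or> n + e \<le> k3"
      using exponent_ge[OF r'(1) gt'(1), of "n + e"] exponent_eq[OF _ lt[of p2]] r(3)
      unfolding y'_def by blast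
    ultimately show False using n e1 e sum by linarith
  qed
qed

lemma S_beta_eq:
  assumes "e \<le> 2"
  shows "S_beta \<beta> (3 * (3 * n + e + 3)) = point_of_gap (cycle_gap n (n + e) (n + 1))"
  unfolding S_beta_def
proof (rule cSup_eq_maximum)
  show "point_of_gap (cycle_gap n (n + e) (n + 1)) \<in> {t \<in> {0..<1}. \<exists>x \<in> survivor_set \<beta> t.
      has_smallest_period T (3 * (3 * n + e + 3)) x}"
    using optimal_point[of n e] point_of_gap_range[OF cycle_gap_bounds] by auto
qed (use survivor_threshold_le[OF assms] in blast)

section \<open>Closed form, monotonicity and limit\<close>

text \<open>Multiplying the definition of \<open>cycle_gap\<close> by the weight \<open>\<beta>^(9n+3e+9)\<close> of the whole cycle clears its negative
  powers. Passing from the gap to the point then produces the denominator \<open>\<beta>^4\<close> instead of \<open>1 - \<beta>^3\<close>; the two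
  forms agree by the cubic equation of \<open>\<beta>\<close>.\<close>

lemma closed_form:
  "point_of_gap (cycle_gap n (n + e) (n + 1)) =
     (1 + \<beta> + \<beta> ^ (3 * n + 5) + \<beta> ^ (6 * n + 3 * e + 7) - \<beta> ^ (3 * n + 4) - \<beta> ^ (6 * n + 3 * e + 6)
        - \<beta> ^ (9 * n + 3 * e + 8) - \<beta> ^ (9 * n + 3 * e + 10))
      / ((1 - \<beta> ^ 3) * (\<beta> ^ (9 * n + 3 * e + 9) - 1))"
proof -
  \<comment> \<open>The powers come in pairs with ratio \<open>\<beta>\<close> or \<open>\<beta>^2\<close>; naming the smaller one makes the claim
    a polynomial identity in \<open>\<beta>, P, Q, R\<close> modulo the cubic.\<close>
  define P Q R where PQR: "P = \<beta> ^ (9 * n + 3 * e + 8)" "Q = \<beta> ^ (6 * n + 3 * e + 6)" "R = \<beta> ^ (3 * n + 4)"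
  have P: "\<beta> ^ (9 * n + 3 * e + 9) = \<beta> * P" "\<beta> ^ (9 * n + 3 * e + 10) = \<beta> ^ 2 * P"
      "\<beta> ^ (6 * n + 3 * e + 7) = \<beta> * Q" "\<beta> ^ (3 * n + 5) = \<beta> * R"
    unfolding PQR by (simp_all flip: power_Suc power_add add: add.commute)
  define A B C where abc: "A = weight n" "B = weight (n + e)" "C = weight (n + 1)"
  have "A * B * C = \<beta> * P" "B * C = \<beta> * Q" "C = \<beta> * R"
    unfolding abc weight_def P(1,3,4)[symmetric] power_add[symmetric]
    by (simp_all add: algebra_simps)
  note prods = this
  have "8 \<le> A * B * C" "0 < A" "0 < B" "0 < C" unfolding abc by (intro weights_ge weight_pos)+
  note pos = this
  have "cycle_gap n (n + e) (n + 1) = (A * B * C + B * C + C) / (A * B * C - 1)"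
    unfolding cycle_gap_def abc[symmetric] using pos by (simp add: field_simps)
  then have c: "cycle_gap n (n + e) (n + 1) = (\<beta> * P + \<beta> * Q + \<beta> * R) / (\<beta> * P - 1)"
    by (simp only: prods(1,2)) (simp only: prods(3))
  have "1 < \<beta> * P" "1 < \<beta> ^ 3" using pos(1)[unfolded prods(1)] root gt_1 square_ge_2 by linarith+
  then have ne: "\<beta> * P - 1 \<noteq> 0" "1 - \<beta> ^ 3 \<noteq> 0" by simp_all
  have key: "(1 - \<beta> ^ 3) * (\<beta> ^ 3 * (\<beta> * P - 1) - (\<beta> * P + \<beta> * Q + \<beta> * R)) =
     \<beta> ^ 4 * (1 + \<beta> + \<beta> * R + \<beta> * Q - R - Q - P - \<beta> ^ 2 * P)"
    using root by algebra
  have "point_of_gap (cycle_gap n (n + e) (n + 1)) = (\<beta> ^ 3 * (\<beta> * P - 1) - (\<beta> * P + \<beta> * Q + \<beta> * R)) / (\<beta> ^ 4 * (\<beta> * P - 1))"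
    unfolding point_of_gap_def c diff_divide_eq_iff[OF ne(1)] by (simp only: divide_divide_eq_left mult.commute[of "\<beta> * P - 1"])
  also have "\<dots> = (1 + \<beta> + \<beta> * R + \<beta> * Q - R - Q - P - \<beta> ^ 2 * P) / ((1 - \<beta> ^ 3) * (\<beta> * P - 1))"
  proof -
    have "X / (\<beta> ^ 4 * d) = Y / (c * d)" if "c * X = \<beta> ^ 4 * Y" "c \<noteq> 0" "d \<noteq> 0" for X Y c d :: real
    proof -
      have "X * (c * d) = (c * X) * d" by (simp only: mult_ac)
      also have "\<dots> = Y * (\<beta> ^ 4 * d)" unfolding that(1) by (simp only: mult_ac)
      finally show ?thesis using that(2,3) by (subst frac_eq_eq) simp_all
    qed
    from this[OF key ne(2,1)] show ?thesis .
  qed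
  finally show ?thesis unfolding P PQR[symmetric] .
qed

text \<open>Along \<open>(n, n, n + 1)\<close>, \<open>(n, n + 1, n + 1)\<close>, \<open>(n, n + 2, n + 1)\<close>, \<open>(n + 1, n + 1, n + 2)\<close> the exponents
  increase lexicographically, so the gaps decrease.\<close>

lemma optimal_cycle_decreasing:
  assumes "e \<le> 2" "e' \<le> 2" "Suc (3 * n + e) = 3 * n' + e'"
  shows "cycle_gap n' (n' + e') (n' + 1) < cycle_gap n (n + e) (n + 1)"
proof (cases "e = 2")
  case True
  then have "n < n'" using assms by presburger
  then show ?thesis by (rule cycle_gap_less)
next
  case False
  then have "n' = n" "e' = Suc e" using assms by presburger+
  then show ?thesis by (simp only:) (rule cycle_gap_less_tail, rule cycle_gap_less, simp)
qed

text \<open>Writing \<open>m = i + 3\<close> makes \<open>n\<close> and \<open>e\<close> quotient and remainder of \<open>i\<close> by three.\<close>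

lemma S_beta_index:
  "S_beta \<beta> (3 * (i + 3)) = point_of_gap (cycle_gap (i div 3) (i div 3 + i mod 3) (i div 3 + 1))"
  using S_beta_eq[of "i mod 3" "i div 3"] by simp

lemma S_beta_strict_mono: "strict_mono (\<lambda>i. S_beta \<beta> (3 * (i + 3)))"
proof (rule strict_monoI_Suc)
  fix i
  have "Suc (3 * (i div 3) + i mod 3) = 3 * (Suc i div 3) + Suc i mod 3" by simp
  then have "cycle_gap (Suc i div 3) (Suc i div 3 + Suc i mod 3) (Suc i div 3 + 1) <
      cycle_gap (i div 3) (i div 3 + i mod 3) (i div 3 + 1)"
    by (intro optimal_cycle_decreasing) simp_all
  then show "S_beta \<beta> (3 * (i + 3)) < S_beta \<beta> (3 * (Suc i + 3))"
    unfolding S_beta_index by (simp add: point_of_gap_def divide_strict_right_mono)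
qed

text \<open>The optimal gap differs from \<open>1\<close> by at most \<open>(\<beta> + 1) / \<beta>^i\<close>, so the thresholds converge to the
  point of gap \<open>1\<close>, the value of \<open>01 (011)\<^sup>\<infinity>\<close>, which is the limit of the optimal itineraries.\<close>

lemma S_beta_limit: "(\<lambda>m. S_beta \<beta> (3 * m)) \<longlonglongrightarrow> (\<beta> ^ 2 + 1) / (\<beta> ^ 4 - \<beta>)"
proof -
  have le: "cycle_gap (i div 3) b c \<le> 1 + (\<beta> + 1) * (1 / \<beta>) ^ i" for i b c
  proof -
    have "\<beta> ^ i \<le> weight (i div 3)"
      unfolding weight_def using gt_1 by (intro power_increasing) (presburger, simp)
    then have "cycle_gap b c (i div 3) / weight (i div 3) \<le> (\<beta> + 1) / \<beta> ^ i"
      using cycle_gap_bounds[of b c "i div 3"] by (intro frac_le) auto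
    then show ?thesis by (simp add: cycle_gap_step[of "i div 3"] power_one_over)
  qed
  have "(\<lambda>i. 1 + (\<beta> + 1) * (1 / \<beta>) ^ i) \<longlonglongrightarrow> 1 + (\<beta> + 1) * 0"
    using gt_1 by (intro tendsto_intros LIMSEQ_power_zero) simp
  then have "(\<lambda>i. 1 + (\<beta> + 1) * (1 / \<beta>) ^ i) \<longlonglongrightarrow> 1" by simp
  note upper = this
  have "(\<lambda>i. cycle_gap (i div 3) (i div 3 + i mod 3) (i div 3 + 1)) \<longlonglongrightarrow> 1"
    by (rule tendsto_sandwich[OF _ _ tendsto_const upper])
       (auto intro!: always_eventually le less_imp_le[OF cycle_gap_bounds(1)])
  then have "(\<lambda>i. S_beta \<beta> (3 * (i + 3))) \<longlonglongrightarrow> (\<beta> ^ 3 - 1) / \<beta> ^ 4"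
    unfolding S_beta_index point_of_gap_def by (intro tendsto_intros) simp_all
  then have "(\<lambda>m. S_beta \<beta> (3 * m)) \<longlonglongrightarrow> (\<beta> ^ 3 - 1) / \<beta> ^ 4"
    by (rule LIMSEQ_offset)
  moreover have "(\<beta> ^ 3 - 1) / \<beta> ^ 4 = (\<beta> ^ 2 + 1) / (\<beta> ^ 4 - \<beta>)"
  proof -
    have "\<beta> ^ 4 - \<beta> \<noteq> 0" using power4 root square_ge_2 gt_1 by linarith
    moreover have "(\<beta> ^ 3 - 1) * (\<beta> ^ 4 - \<beta>) = (\<beta> ^ 2 + 1) * \<beta> ^ 4" using root by algebra
    ultimately show ?thesis by (subst frac_eq_eq) simp_all
  qed
  ultimately show ?thesis by simp
qed

end

interpretation tribonacci: tribonacci_base tribonacci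
  using tribonacci by unfold_locales

theorem corollary5p9:
  fixes \<beta> :: real
  defines "\<beta> \<equiv> tribonacci"
  shows "(\<forall>m z :: nat. 1 \<le> z \<longrightarrow>
      (m = 3*z \<longrightarrow> S_beta \<beta> (3*m) =
        (1 + \<beta> + \<beta>^(3*z+2) + \<beta>^(6*z+1) - \<beta>^(3*z+1) - \<beta>^(6*z) - \<beta>^(9*z-1) - \<beta>^(9*z+1))
          / ((1 - \<beta>^3) * (\<beta>^(9*z) - 1))) \<and>
      (m = 3*z+1 \<longrightarrow> S_beta \<beta> (3*m) =
        (1 + \<beta> + \<beta>^(3*z+2) + \<beta>^(6*z+4) - \<beta>^(3*z+1) - \<beta>^(6*z+3) - \<beta>^(9*z+2) - \<beta>^(9*z+4))
          / ((1 - \<beta>^3) * (\<beta>^(9*z+3) - 1))) \<and>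
      (m = 3*z+2 \<longrightarrow> S_beta \<beta> (3*m) =
        (1 + \<beta> + \<beta>^(3*z+2) + \<beta>^(6*z+7) - \<beta>^(3*z+1) - \<beta>^(6*z+6) - \<beta>^(9*z+5) - \<beta>^(9*z+7))
          / ((1 - \<beta>^3) * (\<beta>^(9*z+6) - 1)))) \<and>
    strict_mono_on {p. \<exists>m\<ge>3. p = 3*m} (S_beta \<beta>) \<and>
    (\<lambda>m. S_beta \<beta> (3*m)) \<longlonglongrightarrow> (\<beta>^2 + 1) / (\<beta>^4 - \<beta>)"
proof (intro conjI allI impI)
  show "(\<lambda>m. S_beta \<beta> (3*m)) \<longlonglongrightarrow> (\<beta>^2 + 1) / (\<beta>^4 - \<beta>)"
    unfolding \<beta>_def by (rule tribonacci.S_beta_limit)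
  show "strict_mono_on {p. \<exists>m\<ge>3. p = 3*m} (S_beta \<beta>)"
  proof (rule strict_mono_onI)
    fix p q :: nat
    assume "p \<in> {p. \<exists>m\<ge>3. p = 3*m}" "q \<in> {p. \<exists>m\<ge>3. p = 3*m}" "p < q"
    then obtain a b where "p = 3 * (a + 3)" "q = 3 * (b + 3)" "a < b"
      by (auto simp: le_iff_add add.commute)
    then show "S_beta \<beta> p < S_beta \<beta> q"
      using strict_monoD[OF tribonacci.S_beta_strict_mono, of a b] unfolding \<beta>_def by simp
  qed
next
  fix m z :: nat
  assume z: "1 \<le> z"
  \<comment> \<open>The least exponent of the optimal cycle is \<open>z - 1\<close>.\<close>
  define n where "n = z - 1"
  have n: "z = n + 1" using z unfolding n_def by simp
  note closed = tribonacci.S_beta_eq[of _ n, unfolded tribonacci.closed_form, folded \<beta>_def]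
  show "S_beta \<beta> (3*m) =
        (1 + \<beta> + \<beta>^(3*z+2) + \<beta>^(6*z+1) - \<beta>^(3*z+1) - \<beta>^(6*z) - \<beta>^(9*z-1) - \<beta>^(9*z+1))
          / ((1 - \<beta>^3) * (\<beta>^(9*z) - 1))" if "m = 3*z"
    using closed[of 0] unfolding that n by (simp add: algebra_simps del: power_Suc)
  show "S_beta \<beta> (3*m) =
        (1 + \<beta> + \<beta>^(3*z+2) + \<beta>^(6*z+4) - \<beta>^(3*z+1) - \<beta>^(6*z+3) - \<beta>^(9*z+2) - \<beta>^(9*z+4))
          / ((1 - \<beta>^3) * (\<beta>^(9*z+3) - 1))" if "m = 3*z+1"
    using closed[of 1] unfolding that n by (simp add: algebra_simps del: power_Suc)
  show "S_beta \<beta> (3*m) =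
        (1 + \<beta> + \<beta>^(3*z+2) + \<beta>^(6*z+7) - \<beta>^(3*z+1) - \<beta>^(6*z+6) - \<beta>^(9*z+5) - \<beta>^(9*z+7))
          / ((1 - \<beta>^3) * (\<beta>^(9*z+6) - 1))" if "m = 3*z+2"
    using closed[of 2] unfolding that n by (simp add: algebra_simps del: power_Suc)
qed

end
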